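(* Let $p>1$. Then $$\frac{p\sin_p(x)}{x}+\frac{\tan_p(x)}{x}>1+p\quad\text{for } 0<x<\frac{\pi_p}{2},$$ and $$\frac{p\sinh_p(x)}{x}+\frac{\tanh_p(x)}{x}>1+p\quad\text{for } x>0.$$
   Context: For $1<p<\infty$ define $\arcsin_p(x)=\int_0^x (1-t^p)^{-1/p}\,dt$ for $0\le x\le 1$, and $\pi_p/2=\arcsin_p(1)$. The generalized sine $\sin_p:[0,\pi_p/2]\to[0,1]$ is the inverse of $\arcsin_p$, $\cos_p(x)=\frac{d}{dx}\sin_p(x)=(1-\sin_p(x)^p)^{1/p}$ on $[0,\pi_p/2]$, and $\tan_p(x)=\sin_p(x)/\cos_p(x)$ on $[0,\pi_p/2)$. Define $\mathrm{arcsinh}_p(x)=\int_0^x (1+t^p)^{-1/p}\,dt$ for $x\ge 0$; $\sinh_p:[0,\infty)\to[0,\infty)$ is the inverse of $\mathrm{arcsinh}_p$, $\cosh_p(x)=\frac{d}{dx}\sinh_p(x)$ (so $\cosh_p(x)^p-\sinh_p(x)^p=1$ for $x\ge0$), and $\tanh_p(x)=\sinh_p(x)/\cosh_p(x)$. *)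

theory Defs
  imports "HOL-Analysis.Analysis"
begin

text \<open>
  Generalized trigonometric and hyperbolic functions with real parameter \<open>p > 1\<close>.
  The integrand of \<open>arcsin_p\<close> is singular at \<open>t = 1\<close>, where HOL's convention
  \<open>0 powr a = 0\<close> assigns it the value 0; this changes the integrand at one point only.
\<close>

definition arcsin_p :: "real \<Rightarrow> real \<Rightarrow> real" where
  "arcsin_p p x = integral {0..x} (\<lambda>t. (1 - t powr p) powr (- 1 / p))"

definition pi_p :: "real \<Rightarrow> real" where
  "pi_p p = 2 * arcsin_p p 1"

text \<open>Only the values on \<open>{0..pi_p p / 2}\<close> are meaningful.\<close>

definition sin_p :: "real \<Rightarrow> real \<Rightarrow> real" where
  "sin_p p = inv_into {0..1} (arcsin_p p)"

text \<open>
  The derivative is taken within the domain of \<open>sin_p\<close>, hence two-sided in the interior and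
  one-sided at the endpoints.
\<close>

definition cos_p :: "real \<Rightarrow> real \<Rightarrow> real" where
  "cos_p p x = vector_derivative (sin_p p) (at x within {0..pi_p p / 2})"

definition tan_p :: "real \<Rightarrow> real \<Rightarrow> real" where
  "tan_p p x = sin_p p x / cos_p p x"

definition arcsinh_p :: "real \<Rightarrow> real \<Rightarrow> real" where
  "arcsinh_p p x = integral {0..x} (\<lambda>t. (1 + t powr p) powr (- 1 / p))"

text \<open>Only the values on \<open>{0..}\<close> are meaningful.\<close>

definition sinh_p :: "real \<Rightarrow> real \<Rightarrow> real" where
  "sinh_p p = inv_into {0..} (arcsinh_p p)"

definition cosh_p :: "real \<Rightarrow> real \<Rightarrow> real" where
  "cosh_p p x = vector_derivative (sinh_p p) (at x within {0..})"

definition tanh_p :: "real \<Rightarrow> real \<Rightarrow> real" where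
  "tanh_p p x = sinh_p p x / cosh_p p x"

end

theory Submission
  imports Defs
begin

text \<open>
  Substituting \<open>x = arcsin_p s\<close> (resp. \<open>arcsinh_p s\<close>), and writing
  \<open>w = (1 \<mp> s\<^sup>p) powr (- 1 / p)\<close>, the claim becomes
  \<open>p * s + s * w > (1 + p) * x\<close>. Both sides vanish at \<open>s = 0\<close>, and the difference of
  their derivatives in \<open>s\<close> is \<open>p + w powr (1 + p) - (1 + p) * w\<close>, which is positive by
  Bernoulli's inequality. The sign \<open>e = \<mp>1\<close> is kept as a parameter to treat both cases at once.
\<close>

text \<open>Adding \<open>1 + p * ln w \<le> w powr p\<close> to \<open>p\<close> times the strict
  bound \<open>- ln w < 1 / w - 1\<close> cancels the logarithms; multiplying by \<open>w\<close>
  gives the claim.\<close>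

lemma powr_Bernoulli_strict:
  fixes p w :: real
  assumes "p > 0" "w > 0" "w \<noteq> 1"
  shows "(1 + p) * w < p + w powr (1 + p)"
proof -
  have "1 + p * ln w \<le> w powr p"
    using exp_ge_add_one_self[of "p * ln w"] assms by (simp add: powr_def)
  moreover have "- ln w < 1 / w - 1"
    using ln_le_minus_one[of "1 / w"] ln_eq_minus_one[of "1 / w"] assms
    by (fastforce simp: ln_div)
  then have "p * (1 - ln w) < p * (1 / w)"
    using assms by (intro mult_strict_left_mono) auto
  ultimately have "w * (1 + p) < w * (w powr p + p / w)"
    using assms by (intro mult_strict_left_mono) (auto simp: algebra_simps)
  then show ?thesis
    using assms by (simp add: powr_add algebra_simps)
qed

context
  fixes e p :: real and f F :: "real \<Rightarrow> real"
  assumes p: "p > 1"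
  defines "f \<equiv> \<lambda>t. (1 + e * t powr p) powr (- 1 / p)"
  defines "F \<equiv> \<lambda>x. integral {0..x} f"
begin

lemma continuous_on_integrand:
  assumes "\<And>t. t \<in> {0..s} \<Longrightarrow> 0 < 1 + e * t powr p"
  shows "continuous_on {0..s} f"
  unfolding f_def using assms p
  by (intro continuous_intros continuous_on_powr') (auto simp: less_imp_neq[symmetric])

lemma DERIV_integral:
  assumes "\<And>t. t \<in> {0..s} \<Longrightarrow> 0 < 1 + e * t powr p" "0 < t" "t < s"
  shows "(F has_real_derivative f t) (at t)"
proof -
  have "(F has_real_derivative f t) (at t within {0..s})"
    unfolding F_def using assms
    by (intro integral_has_real_derivative continuous_on_integrand) auto
  moreover have "at t within {0..s} = at t"
    using assms by (intro at_within_interior) auto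
  ultimately show ?thesis by simp
qed

lemma integral_less:
  assumes pos: "\<And>t. t \<in> {0..s} \<Longrightarrow> 0 < 1 + e * t powr p" and "e \<noteq> 0" "0 < s"
  shows "(1 + p) * F s < p * s + s * f s"
proof -
  define D where "D = (\<lambda>s. p * s + s * f s - (1 + p) * F s)"
  have "D 0 < D s"
  proof (rule DERIV_pos_imp_increasing_open[OF \<open>0 < s\<close>])
    fix t assume t: "0 < t" "t < s"
    define u where "u = 1 + e * t powr p"
    have u: "u > 0" "u \<noteq> 1"
      using pos[of t] t \<open>e \<noteq> 0\<close> by (auto simp: u_def)
    have ft: "f t = u powr (- 1 / p)"
      by (simp add: f_def u_def)
    have "(f has_real_derivative (- 1 / p) * u powr (- 1 / p - 1) * (e * (p * t powr (p - 1)))) (at t)"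
      unfolding f_def u_def using t u p
      by (auto intro!: derivative_eq_intros simp: u_def)
    then have "(D has_real_derivative
        p + (f t + t * ((- 1 / p) * u powr (- 1 / p - 1) * (e * (p * t powr (p - 1)))))
        - (1 + p) * f t) (at t)"
      unfolding D_def
      by (auto intro!: derivative_eq_intros DERIV_integral[OF pos] t)
    \<comment> \<open>Since \<open>e * t powr p = u - 1\<close>, the second summand is
      \<open>(1 - u) * u powr (- 1 / p - 1)\<close>, while
      \<open>f t = u * u powr (- 1 / p - 1)\<close>. The terms with factor \<open>u\<close>
      cancel.\<close>
    moreover have "f t + t * ((- 1 / p) * u powr (- 1 / p - 1) * (e * (p * t powr (p - 1))))
        = f t powr (1 + p)"
    proof -
      have "t * t powr (p - 1) = t powr p"
        using t by (simp add: powr_mult_base)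
      then have "t * ((- 1 / p) * u powr (- 1 / p - 1) * (e * (p * t powr (p - 1))))
          = (1 - u) * u powr (- 1 / p - 1)"
        using p by (simp add: u_def field_simps)
      moreover have "f t = u * u powr (- 1 / p - 1)"
        using u by (simp add: ft powr_mult_base)
      moreover have "(- 1 / p) * (1 + p) = - 1 / p - 1"
        using p by (simp add: field_simps)
      then have "f t powr (1 + p) = u powr (- 1 / p - 1)"
        by (simp only: ft powr_powr)
      ultimately show ?thesis by (simp add: algebra_simps)
    qed
    moreover have "(1 + p) * f t < p + f t powr (1 + p)"
    \<comment> \<open>Strictness comes from \<open>u \<noteq> 1\<close>, that is, from
      \<open>e \<noteq> 0\<close> and \<open>t > 0\<close>.\<close>
    proof (rule powr_Bernoulli_strict)
      have "u powr (- 1 / p) \<noteq> 1"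
        using u p by (simp add: powr_def)
      then show "f t \<noteq> 1" by (simp add: ft)
    qed (use p u in \<open>auto simp: ft\<close>)
    ultimately show "\<exists>y. (D has_real_derivative y) (at t) \<and> 0 < y"
      by (intro exI[of _ "p + f t powr (1 + p) - (1 + p) * f t"]) simp
  next
    have "f integrable_on {0..s}"
      using pos by (intro integrable_continuous_real continuous_on_integrand)
    then show "continuous_on {0..s} D"
      unfolding D_def F_def using pos
      by (intro continuous_intros continuous_on_integrand indefinite_integral_continuous_1)
  qed
  then show ?thesis by (simp add: D_def F_def)
qed

text \<open>
  \<open>S\<close> is the open interval on which \<open>F\<close> is inverted, while \<open>D\<close> and \<open>R\<close> may contain endpoints.
\<close>

lemma inv_into_integral_less:
  assumes pos: "\<And>t. t \<in> {0..s} \<Longrightarrow> 0 < 1 + e * t powr p" and "e \<noteq> 0" "0 < s"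
    and deriv: "\<And>t. t \<in> S \<Longrightarrow> (F has_real_derivative f t) (at t)"
    and S: "open S" "s \<in> S" "S \<subseteq> D" and inj: "inj_on F D" and R: "F s \<in> interior R"
    and "0 < F s"
  defines "g \<equiv> inv_into D F"
  shows "1 + p < p * g (F s) / F s + g (F s) / vector_derivative g (at (F s) within R) / F s"
proof -
  have g: "g (F t) = t" if "t \<in> S" for t
    using that S inj by (auto simp: g_def)
  have fs: "f s \<noteq> 0"
    using pos[of s] \<open>0 < s\<close> by (simp add: f_def)
  have "continuous_on S F"
    by (rule DERIV_continuous_on) (rule has_field_derivative_at_within[OF deriv])
  moreover have "(F has_derivative (\<lambda>h. f s * h)) (at s)"
    using deriv[OF \<open>s \<in> S\<close>] by (simp add: has_field_derivative_def)
  \<comment> \<open>By the inverse function theorem, \<open>g\<close> has slope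
    \<open>1 / f s\<close> at \<open>F s\<close>. Dividing \<open>g (F s) = s\<close> by this slope
    produces the term \<open>s * f s\<close> of \<open>integral_less\<close>.\<close>
  ultimately have "(g has_derivative (\<lambda>h. h / f s)) (at (F s))"
    using has_derivative_inverse_strong[of S s F g "\<lambda>h. f s * h" "\<lambda>h. h / f s"] S(1,2) g fs
    by (simp add: fun_eq_iff)
  then have "(g has_vector_derivative 1 / f s) (at (F s) within R)"
    by (simp add: has_vector_derivative_def has_derivative_at_withinI)
  \<comment> \<open>A nontrivial filter makes the derivative unique, so the value chosen by
    \<open>vector_derivative\<close> is the computed one.\<close>
  moreover have "at (F s) within R \<noteq> bot"
    using at_within_interior[OF R] by simp
  ultimately have "vector_derivative g (at (F s) within R) = 1 / f s"
    by (intro vector_derivative_within)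
  moreover have "1 + p < (p * s + s * f s) / F s"
    using integral_less[OF pos \<open>e \<noteq> 0\<close> \<open>0 < s\<close>] \<open>0 < F s\<close> by (simp only: pos_less_divide_eq)
  ultimately show ?thesis
    by (simp add: g[OF \<open>s \<in> S\<close>] add_divide_distrib)
qed

end

text \<open>The derivative is demanded only strictly between points of \<open>D\<close>, so
  \<open>D\<close> may contain the endpoint 1, where the integrand of \<open>arcsin_p\<close> is
  singular.\<close>

lemma strict_mono_on_if_DERIV_pos:
  fixes F :: "real \<Rightarrow> real"
  assumes cont: "\<And>a b. a \<in> D \<Longrightarrow> b \<in> D \<Longrightarrow> continuous_on {a..b} F"
    and deriv: "\<And>a b t. a \<in> D \<Longrightarrow> b \<in> D \<Longrightarrow> a < t \<Longrightarrow> t < b \<Longrightarrow>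
      (F has_real_derivative f t) (at t) \<and> 0 < f t"
  shows "strict_mono_on D F"
proof (rule strict_mono_onI)
  fix a b assume D: "a \<in> D" "b \<in> D" and "a < b"
  show "F a < F b"
  proof (rule DERIV_pos_imp_increasing_open[OF \<open>a < b\<close> _ cont[OF D]])
    show "\<exists>y. (F has_real_derivative y) (at t) \<and> 0 < y" if "a < t" "t < b" for t
      using deriv[OF D that] by (rule exI)
  qed
qed

lemma arcsin_p_altdef: "arcsin_p p = (\<lambda>x. integral {0..x} (\<lambda>t. (1 + (- 1) * t powr p) powr (- 1 / p)))"
  by (simp add: arcsin_p_def fun_eq_iff)

lemma arcsinh_p_altdef: "arcsinh_p p = (\<lambda>x. integral {0..x} (\<lambda>t. (1 + 1 * t powr p) powr (- 1 / p)))"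
  by (simp add: arcsinh_p_def fun_eq_iff)

lemma sin_p_tan_p_ineq:
  assumes p: "p > 1" and x: "0 < x" "x < pi_p p / 2"
  shows "1 + p < p * sin_p p x / x + tan_p p x / x"
proof -
  define f where "f = (\<lambda>t. (1 + (- 1) * t powr p) powr (- 1 / p))"
  have F: "arcsin_p p = (\<lambda>x. integral {0..x} f)"
    unfolding arcsin_p_altdef f_def ..
  have F': "integral {0..x} f = arcsin_p p x" for x
    by (simp add: F)
  have pos: "0 < 1 + (- 1) * t powr p" if "t \<in> {0..s}" "s < 1" for s t
    using that p powr_less_mono2[of p t 1] by auto
  have deriv: "(arcsin_p p has_real_derivative f t) (at t)" if t: "t \<in> {0<..<1}" for t
  proof -
    \<comment> \<open>\<open>DERIV_integral\<close> needs positivity on a closed interval around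
      \<open>t\<close>, which must stop short of 1.\<close>
    obtain s where "t < s" "s < 1" using t dense[of t 1] by auto
    then show ?thesis
      using DERIV_integral[OF p, of s "- 1" t] pos[of _ s] t unfolding F f_def by simp
  qed
  text \<open>
    A non-integrable \<open>f\<close> would make \<open>pi_p p = 0\<close>, so integrability up to the singularity at 1
    is implied by \<open>0 < x < pi_p p / 2\<close>.
  \<close>
  have "integral {0..1} f \<noteq> 0"
    using x by (simp add: pi_p_def F)
  then have "f integrable_on {0..1}"
    using not_integrable_integral by blast
  then have cont: "continuous_on {0..1} (arcsin_p p)"
    unfolding F by (rule indefinite_integral_continuous_1)
  have "strict_mono_on {0..1} (arcsin_p p)"
  proof (rule strict_mono_on_if_DERIV_pos[where f = f])
    fix a b t :: real assume "a \<in> {0..1}" "b \<in> {0..1}" "a < t" "t < b"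
    then show "(arcsin_p p has_real_derivative f t) (at t) \<and> 0 < f t"
      using deriv[of t] pos[of t t] by (auto simp: f_def)
  qed (auto intro: continuous_on_subset[OF cont])
  then have inj: "inj_on (arcsin_p p) {0..1}"
    by (rule strict_mono_on_imp_inj_on)
  obtain s where s: "s \<in> {0..1}" "arcsin_p p s = x"
    using IVT'[of "arcsin_p p" 0 x 1] cont x by (auto simp: F pi_p_def)
  \<comment> \<open>The endpoints are mapped to \<open>0\<close> and \<open>pi_p p / 2\<close>, both
    excluded by the bounds on \<open>x\<close>.\<close>
  have "s \<noteq> 0" "s \<noteq> 1"
    using s x by (auto simp: F pi_p_def)
  then have s': "s \<in> {0<..<1}"
    using s by auto
  then show ?thesis
    using inv_into_integral_less[OF p, of s "- 1" "{0<..<1}" "{0..1}" "{0..pi_p p / 2}",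
        folded f_def, unfolded F'] pos[of _ s] deriv[unfolded f_def] inj x s(2)
    by (auto simp: sin_p_def tan_p_def cos_p_def subset_eq)
qed

text \<open>Needed for every \<open>x > 0\<close> to be a value of \<open>arcsinh_p\<close>. For
  \<open>t \<ge> 1\<close>, \<open>1 + t powr p \<le> 2 * t powr p\<close> bounds the integrand
  below by a multiple of \<open>1 / t\<close>, so the integral grows at least
  logarithmically.\<close>

lemma arcsinh_p_unbounded:
  assumes p: "p > 1"
  obtains s where "0 \<le> s" "x \<le> arcsinh_p p s"
proof -
  define f where "f = (\<lambda>t. (1 + 1 * t powr p) powr (- 1 / p))"
  have F: "arcsinh_p p = (\<lambda>x. integral {0..x} f)"
    unfolding arcsinh_p_altdef f_def ..
  have pos: "0 < 1 + 1 * t powr p" for t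
    by (simp add: add_pos_nonneg)
  define c where "c = 2 powr (- 1 / p)"
  have c: "c > 0" by (simp add: c_def)
  have ge: "c * ln s \<le> arcsinh_p p s" if "1 \<le> s" for s
  proof -
    have "arcsinh_p p 1 - c * ln 1 \<le> arcsinh_p p s - c * ln s"
    proof (rule DERIV_nonneg_imp_nondecreasing[OF that])
      fix t assume t: "1 \<le> t" "t \<le> s"
      have "(arcsinh_p p has_real_derivative f t) (at t)"
        using DERIV_integral[OF p, of "t + 1" 1 t] pos t unfolding F f_def by simp
      then have "((\<lambda>s. arcsinh_p p s - c * ln s) has_real_derivative f t - c / t) (at t)"
        using t by (auto intro!: derivative_eq_intros)
      moreover have "c / t \<le> f t"
      proof -
        have "c / t = (2 * t powr p) powr (- 1 / p)"
          using t p by (simp add: c_def powr_mult powr_powr powr_minus_divide)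
        also have "\<dots> \<le> f t"
          unfolding f_def using t p ge_one_powr_ge_zero[of t p]
          by (intro powr_mono2') (auto simp: add_pos_nonneg)
        finally show ?thesis .
      qed
      ultimately show "\<exists>y. ((\<lambda>s. arcsinh_p p s - c * ln s) has_real_derivative y) (at t) \<and> 0 \<le> y"
        by (intro exI[of _ "f t - c / t"]) simp
    qed
    moreover have "0 \<le> arcsinh_p p 1"
      unfolding F f_def by (rule integral_nonneg)
        (use pos continuous_on_integrand[OF p, of 1 1] in \<open>auto intro: integrable_continuous_real\<close>)
    ultimately show ?thesis by simp
  qed
  show thesis
  proof (rule that)
    \<comment> \<open>The maximum with 0 keeps the witness at least 1, as \<open>ge\<close>
      requires.\<close>
    have "x \<le> c * ln (exp (max 0 (x / c)))"
      using c by (simp add: max_def field_simps)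
    also have "\<dots> \<le> arcsinh_p p (exp (max 0 (x / c)))"
      by (rule ge) simp
    finally show "x \<le> arcsinh_p p (exp (max 0 (x / c)))" .
  qed simp
qed

lemma sinh_p_tanh_p_ineq:
  assumes p: "p > 1" and x: "0 < x"
  shows "1 + p < p * sinh_p p x / x + tanh_p p x / x"
proof -
  define f where "f = (\<lambda>t. (1 + 1 * t powr p) powr (- 1 / p))"
  have F: "arcsinh_p p = (\<lambda>x. integral {0..x} f)"
    unfolding arcsinh_p_altdef f_def ..
  have F': "integral {0..x} f = arcsinh_p p x" for x
    by (simp add: F)
  have pos: "0 < 1 + 1 * t powr p" for t
    by (simp add: add_pos_nonneg)
  have deriv: "(arcsinh_p p has_real_derivative f t) (at t)" if "t \<in> {0<..}" for t
    using DERIV_integral[OF p, of "t + 1" 1 t] pos that unfolding F f_def by simp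
  have "f integrable_on {0..s}" for s
    unfolding f_def using pos by (intro integrable_continuous_real continuous_on_integrand[OF p])
  then have cont: "continuous_on {0..s} (arcsinh_p p)" for s
    unfolding F by (rule indefinite_integral_continuous_1)
  have "strict_mono_on {0..} (arcsinh_p p)"
  proof (rule strict_mono_on_if_DERIV_pos[where f = f])
    fix a b t :: real assume "a \<in> {0..}" "b \<in> {0..}" "a < t" "t < b"
    then show "(arcsinh_p p has_real_derivative f t) (at t) \<and> 0 < f t"
      using deriv[of t] pos[of t] by (auto simp: f_def)
  qed (auto intro: continuous_on_subset[OF cont])
  then have inj: "inj_on (arcsinh_p p) {0..}"
    by (rule strict_mono_on_imp_inj_on)
  \<comment> \<open>The domain has no right endpoint, so unboundedness supplies one for the
    intermediate value theorem.\<close>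
  obtain b where "0 \<le> b" "x \<le> arcsinh_p p b"
    using arcsinh_p_unbounded[OF p] .
  then obtain s where s: "0 \<le> s" "arcsinh_p p s = x"
    using IVT'[of "arcsinh_p p" 0 x b] cont x by (auto simp: F)
  moreover have "s \<noteq> 0"
    using s x by (auto simp: F)
  ultimately show ?thesis
    using inv_into_integral_less[OF p, of s 1 "{0<..}" "{0..}" "{0..}",
        folded f_def, unfolded F'] pos deriv[unfolded f_def] inj x
    by (auto simp: sinh_p_def tanh_p_def cosh_p_def subset_eq)
qed

theorem theorem3p16:
  fixes p :: real
  assumes "p > 1"
  shows "(\<forall>x::real. 0 < x \<and> x < pi_p p / 2 \<longrightarrow>
            p * sin_p p x / x + tan_p p x / x > 1 + p) \<and>
         (\<forall>x::real. x > 0 \<longrightarrow>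
            p * sinh_p p x / x + tanh_p p x / x > 1 + p)"
  using sin_p_tan_p_ineq[OF assms] sinh_p_tanh_p_ineq[OF assms] by blast

end
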